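(* Suppose that the mirror map $\chi$ satisfies Assumptions 1 and 2 stated in the context. Let $x^\star$ be a minimizer of $f$ over $\mathcal{X}$ and let $$\widehat V(x,\zeta,t)=\frac{t^2}{r^2}\big(f(x)-f(x^\star)\big)+D_\phi\big(x^\star,\chi(\zeta)\big).$$ If $r\ge2$, then along solutions $(\zeta(t),x(t))$ of the system $$\dot\zeta(t)=-\frac{t}{r}\nabla f(x(t)),\qquad \dot x(t)=\frac{r}{t}\big(\chi(\zeta(t))-x(t)\big),$$ one has $\dfrac{d}{dt}\widehat V(x(t),\zeta(t),t)\le0$ for $t>0$.
   Context: $\mathbb{E}$ denotes $\mathbb{R}^d$ with an arbitrary norm $\|\cdot\|$, $\mathbb{E}^\star$ is its dual with dual norm $\|\cdot\|_\star$, and $\langle\zeta,x\rangle=\sum_j\zeta_jx_j$ is the pairing between $\zeta\in\mathbb{E}^\star$ and $x\in\mathbb{E}$. The set $\mathcal{X}\subseteq\mathbb{R}^d$ is non-empty, closed and convex, with relative interior $\mathrm{ri}(\mathcal{X})$ and indicator function $\delta_{\mathcal{X}}$ ($0$ on $\mathcal{X}$, $\infty$ elsewhere); $f$ is a real-valued function that is convex and continuously differentiable in an open set containing $\mathcal{X}$; $\nabla f(x)\in\mathbb{E}^\star$. Assumption 1: $\chi=\nabla\psi^\star$ for some convex and differentiable $\psi^\star:\mathbb{E}^\star\to\mathbb{R}$, $\chi$ takes values in $\mathcal{X}$, and $\|\chi(\xi)-\chi(\zeta)\|\le L_\chi\|\xi-\zeta\|_\star$ for all $\xi,\zeta\in\mathbb{E}^\star$.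 Assumption 2: $\chi=\nabla\psi^\star$ is differentiable and its image is $\mathrm{ri}(\mathcal{X})$. In addition, $\psi^\star$ is the convex conjugate of $\psi=\phi+\delta_{\mathcal{X}}$ (i.e. $\psi^\star(\zeta)=\sup_{x\in\mathbb{E}}\{\langle\zeta,x\rangle-\psi(x)\}$), where $\phi:\mathbb{E}\to(-\infty,\infty]$ is proper, convex, differentiable over $\mathrm{ri}(\mathcal{X})$ and satisfies $\mathcal{X}\subseteq\mathrm{dom}(\phi)$. Primal Bregman divergence: for $x\in\mathcal{X}$, $z\in\mathrm{ri}(\mathcal{X})$, $D_\phi(x,z)=\phi(x)-\phi(z)-\langle\nabla\phi(z),x-z\rangle$. A solution of the system means a continuously differentiable pair $(\zeta(t),x(t))$, $0\le t<\infty$, with values in $\mathbb{E}^\star\times\mathcal{X}$, satisfying the equations for $t>0$, with initial data $(\zeta(0),x(0))\in\mathbb{E}^\star\times\mathcal{X}$ such that $\chi(\zeta(0))=x(0)$. *)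

theory Defs
  imports "HOL-Analysis.Analysis"
begin

text \<open>Both \<open>E\<close> and its dual are modelled by \<^typ>\<open>real ^ 'n\<close>, with the inner product as the
  pairing. The norm of \<open>E\<close> is an explicit function \<open>N\<close>, unrelated to the type-class norm; since
  all norms on a finite-dimensional space are equivalent, the library's topological and
  differential notions apply unchanged.\<close>

definition is_norm :: "(real ^ 'n \<Rightarrow> real) \<Rightarrow> bool" where
  "is_norm N \<longleftrightarrow>
     (\<forall>x. N x = 0 \<longleftrightarrow> x = 0) \<and>
     (\<forall>c x. N (c *\<^sub>R x) = \<bar>c\<bar> * N x) \<and>
     (\<forall>x y. N (x + y) \<le> N x + N y)"

definition dual_norm :: "(real ^ 'n \<Rightarrow> real) \<Rightarrow> real ^ 'n \<Rightarrow> real" where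
  "dual_norm N \<zeta> = (SUP x\<in>{x. N x \<le> 1}. \<zeta> \<bullet> x)"

text \<open>The gradient is meaningful only at points of differentiability; see \<open>GDERIV_grad\<close>.\<close>

definition grad :: "(real ^ 'n \<Rightarrow> real) \<Rightarrow> real ^ 'n \<Rightarrow> real ^ 'n" where
  "grad f x = (THE D. GDERIV f x :> D)"

lemma GDERIV_grad:
  fixes f :: "real ^ 'n \<Rightarrow> real"
  assumes "f differentiable (at x)"
  shows "GDERIV f x :> grad f x"
proof -
  from assms obtain f' where f': "(f has_derivative f') (at x)"
    by (auto simp: differentiable_def)
  then have lin: "linear f'"
    by (rule has_derivative_linear)
  define g where "g = adjoint f' 1"
  have "f' = (\<lambda>h. h \<bullet> g)"
  proof
    show "f' h = h \<bullet> g" for h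
      using adjoint_works[OF lin, of h 1] by (simp add: g_def)
  qed
  then have ex: "GDERIV f x :> g"
    using f' by (simp add: gderiv_def)
  show ?thesis
    unfolding grad_def
  proof (rule theI)
    show "GDERIV f x :> g" by (fact ex)
  next
    fix D assume "GDERIV f x :> D"
    with ex have "(\<lambda>h. h \<bullet> D) = (\<lambda>h. h \<bullet> g)"
      unfolding gderiv_def by (blast intro: has_derivative_unique)
    then have "\<forall>h. h \<bullet> D = h \<bullet> g"
      by (rule fun_eq_iff[THEN iffD1])
    then show "D = g"
      by (rule vector_eq_ldot[THEN iffD1])
  qed
qed

definition edom :: "('a \<Rightarrow> ereal) \<Rightarrow> 'a set" where
  "edom \<phi> = {x. \<phi> x < \<infinity>}"

definition eproper :: "('a \<Rightarrow> ereal) \<Rightarrow> bool" where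
  "eproper \<phi> \<longleftrightarrow> (\<forall>x. \<phi> x \<noteq> -\<infinity>) \<and> edom \<phi> \<noteq> {}"

text \<open>Intended for functions without the value \<open>-\<infinity>\<close>. For \<open>t = 0\<close> and \<open>t = 1\<close> the
  convention \<open>0 * \<infinity> = 0\<close> makes the inequality trivial.\<close>

definition econvex :: "('a::real_vector \<Rightarrow> ereal) \<Rightarrow> bool" where
  "econvex \<phi> \<longleftrightarrow> (\<forall>x y. \<forall>t\<in>{0..1}.
     \<phi> ((1 - t) *\<^sub>R x + t *\<^sub>R y) \<le> ereal (1 - t) * \<phi> x + ereal t * \<phi> y)"

text \<open>The interior condition is needed because \<^const>\<open>real_of_ereal\<close> maps \<open>\<infinity>\<close> to \<open>0\<close>.\<close>

definition edifferentiable_at :: "('a::real_normed_vector \<Rightarrow> ereal) \<Rightarrow> 'a \<Rightarrow> bool" where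
  "edifferentiable_at \<phi> z \<longleftrightarrow>
     z \<in> interior (edom \<phi>) \<and> (\<lambda>x. real_of_ereal (\<phi> x)) differentiable (at z)"

definition convex_indicator :: "'a set \<Rightarrow> 'a \<Rightarrow> ereal" where
  "convex_indicator X x = (if x \<in> X then 0 else \<infinity>)"

definition convex_conjugate :: "(real ^ 'n \<Rightarrow> ereal) \<Rightarrow> real ^ 'n \<Rightarrow> ereal" where
  "convex_conjugate \<psi> \<zeta> = (SUP x. ereal (\<zeta> \<bullet> x) - \<psi> x)"

definition mirror_assumption1 ::
  "(real ^ 'n \<Rightarrow> real) \<Rightarrow> (real ^ 'n) set \<Rightarrow> (real ^ 'n \<Rightarrow> real) \<Rightarrow> real \<Rightarrow>
   (real ^ 'n \<Rightarrow> real ^ 'n) \<Rightarrow> bool" where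
  "mirror_assumption1 N X \<psi>s L chi \<longleftrightarrow>
     convex_on UNIV \<psi>s \<and>
     (\<forall>\<zeta>. \<psi>s differentiable (at \<zeta>)) \<and>
     chi = grad \<psi>s \<and>
     range chi \<subseteq> X \<and>
     (\<forall>\<xi> \<zeta>. N (chi \<xi> - chi \<zeta>) \<le> L * dual_norm N (\<xi> - \<zeta>))"

definition mirror_assumption2 ::
  "(real ^ 'n) set \<Rightarrow> (real ^ 'n \<Rightarrow> ereal) \<Rightarrow> (real ^ 'n \<Rightarrow> real) \<Rightarrow>
   (real ^ 'n \<Rightarrow> real ^ 'n) \<Rightarrow> bool" where
  "mirror_assumption2 X \<phi> \<psi>s chi \<longleftrightarrow>
     (\<forall>\<zeta>. chi differentiable (at \<zeta>)) \<and>
     range chi = rel_interior X \<and>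
     (\<forall>\<zeta>. ereal (\<psi>s \<zeta>) = convex_conjugate (\<lambda>x. \<phi> x + convex_indicator X x) \<zeta>) \<and>
     eproper \<phi> \<and>
     econvex \<phi> \<and>
     (\<forall>z\<in>rel_interior X. edifferentiable_at \<phi> z) \<and>
     X \<subseteq> edom \<phi>"

text \<open>Used for \<open>x\<close> and \<open>z\<close> where \<open>\<phi>\<close> is finite, and with \<open>\<phi>\<close> differentiable at \<open>z\<close>.\<close>

definition bregman :: "(real ^ 'n \<Rightarrow> ereal) \<Rightarrow> real ^ 'n \<Rightarrow> real ^ 'n \<Rightarrow> real" where
  "bregman \<phi> x z =
     real_of_ereal (\<phi> x) - real_of_ereal (\<phi> z)
       - grad (\<lambda>y. real_of_ereal (\<phi> y)) z \<bullet> (x - z)"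

text \<open>Unlike \<^const>\<open>C1_differentiable_on\<close>, this takes derivatives within \<open>S\<close>, hence one-sided
  at the left endpoint of \<open>{0..}\<close>.\<close>

definition C1_within :: "real set \<Rightarrow> (real \<Rightarrow> 'a::real_normed_vector) \<Rightarrow> bool" where
  "C1_within S u \<longleftrightarrow>
     (\<exists>u'. (\<forall>t\<in>S. (u has_vector_derivative u' t) (at t within S)) \<and> continuous_on S u')"

definition accelerated_mirror_solution ::
  "(real ^ 'n) set \<Rightarrow> (real ^ 'n \<Rightarrow> real) \<Rightarrow> (real ^ 'n \<Rightarrow> real ^ 'n) \<Rightarrow> real \<Rightarrow>
   (real \<Rightarrow> real ^ 'n) \<Rightarrow> (real \<Rightarrow> real ^ 'n) \<Rightarrow> bool" where
  "accelerated_mirror_solution X f chi r \<zeta> x \<longleftrightarrow>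
     C1_within {0..} \<zeta> \<and> C1_within {0..} x \<and>
     (\<forall>t\<ge>0. x t \<in> X) \<and>
     chi (\<zeta> 0) = x 0 \<and>
     (\<forall>t>0. (\<zeta> has_vector_derivative (- (t / r) *\<^sub>R grad f (x t))) (at t)) \<and>
     (\<forall>t>0. (x has_vector_derivative ((r / t) *\<^sub>R (chi (\<zeta> t) - x t))) (at t))"

definition Vhat ::
  "(real ^ 'n \<Rightarrow> real) \<Rightarrow> (real ^ 'n \<Rightarrow> ereal) \<Rightarrow> (real ^ 'n \<Rightarrow> real ^ 'n) \<Rightarrow> real \<Rightarrow> real ^ 'n \<Rightarrow>
   real ^ 'n \<Rightarrow> real ^ 'n \<Rightarrow> real \<Rightarrow> real" where
  "Vhat f \<phi> chi r xstar x \<zeta> t =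
     t\<^sup>2 / r\<^sup>2 * (f x - f xstar) + bregman \<phi> xstar (chi \<zeta>)"

end

theory Submission
  imports Defs
begin

text \<open>The Bregman term, which involves the gradient of \<open>\<phi>\<close> along the moving point
  \<open>chi (\<zeta> t)\<close>, is first traded for an expression in the dual variable:
  \<open>D\<^sub>\<phi>(p, chi \<eta>) = \<phi> p + \<psi>s \<eta> - \<eta> \<bullet> p\<close> for \<open>p \<in> X\<close> (lemma \<open>bregman_mirror\<close>). Thus no
  second derivative of \<open>\<phi>\<close> ever occurs, and since \<open>chi\<close> is the gradient of \<open>\<psi>s\<close>, the term
  changes along a trajectory at rate \<open>(chi \<zeta> - p) \<bullet> \<zeta>'\<close>.

  The identity rests on two facts about \<open>z = chi \<eta>\<close>. The point \<open>z\<close> attains the supremum that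
  defines \<open>\<psi>s \<eta>\<close> (lemma \<open>mirror_Fenchel_equality\<close>); this is the one place where biduality might
  seem necessary, but the differentiability of \<open>\<phi>\<close> at \<open>z\<close> supplies a subgradient there, and the
  tangent inequalities of \<open>\<phi>\<close> at \<open>z\<close> and of \<open>\<psi>s\<close> at \<open>\<eta>\<close> suffice. Moreover the gradient of \<open>\<phi>\<close>
  at \<open>z\<close> and \<open>\<eta>\<close> itself, though they may differ when \<open>X\<close> has empty interior, agree on the
  directions \<open>p - z\<close>, because \<open>z\<close> is a relatively interior minimizer of \<open>\<phi> - \<eta> \<bullet> _\<close> over \<open>X\<close>
  (lemma \<open>rel_interior_minimizer_gradient\<close>).

  With this, the equations of motion make the two terms containing \<open>chi \<zeta>\<close> cancel, and the
  derivative of the Lyapunov function is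
  \<open>2 t / r\<^sup>2 (f x - f xstar) + t / r (grad f x \<bullet> (xstar - x))\<close>. Convexity of \<open>f\<close> bounds it by
  \<open>t / r\<^sup>2 (2 - r) (f x - f xstar)\<close>, which is nonpositive for \<open>r \<ge> 2\<close>.\<close>

lemma GDERIV_along_line:
  fixes h :: "'a::real_inner \<Rightarrow> real"
  assumes "GDERIV h z :> D"
  shows "((\<lambda>s. h (z + s *\<^sub>R d)) has_real_derivative D \<bullet> d) (at 0)"
proof -
  have line: "((\<lambda>s. z + s *\<^sub>R d) has_derivative (\<lambda>s. s *\<^sub>R d)) (at 0)"
    by (auto intro!: derivative_eq_intros)
  have "(h has_derivative (\<lambda>v. v \<bullet> D)) (at (z + 0 *\<^sub>R d))"
    using assms by (simp add: gderiv_def)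
  from has_derivative_compose[OF line this]
  have "((\<lambda>s. h (z + s *\<^sub>R d)) has_derivative (\<lambda>s. (s *\<^sub>R d) \<bullet> D)) (at 0)" .
  moreover have "(\<lambda>s. (s *\<^sub>R d) \<bullet> D) = (*) (D \<bullet> d)"
    by (auto simp: inner_commute)
  ultimately show ?thesis
    by (simp add: has_field_derivative_def)
qed

lemma GDERIV_vector_derivative:
  fixes h :: "'a::real_inner \<Rightarrow> real"
  assumes "GDERIV h (u t) :> D" "(u has_vector_derivative v) (at t)"
  shows "((\<lambda>s. h (u s)) has_real_derivative D \<bullet> v) (at t)"
proof -
  have "((\<lambda>s. h (u s)) has_derivative (\<lambda>s. (s *\<^sub>R v) \<bullet> D)) (at t)"
    using assms unfolding has_vector_derivative_def gderiv_def
    by (rule has_derivative_compose[rotated])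
  moreover have "(\<lambda>s. (s *\<^sub>R v) \<bullet> D) = (*) (D \<bullet> v)"
    by (auto simp: inner_commute)
  ultimately show ?thesis
    by (simp add: has_field_derivative_def)
qed

text \<open>Only the convexity inequality on the segment from \<open>z\<close> to \<open>y\<close> enters, which makes the lemma
  applicable to the finite part of an extended-valued function, whose real-valued extension by
  \<open>0\<close> need not be convex.\<close>

lemma tangent_below_on_segment:
  fixes h :: "'a::real_inner \<Rightarrow> real"
  assumes D: "GDERIV h z :> D"
    and conv: "\<And>t. 0 \<le> t \<Longrightarrow> t \<le> 1 \<Longrightarrow> h ((1 - t) *\<^sub>R z + t *\<^sub>R y) \<le> (1 - t) * h z + t * h y"
  shows "h z + D \<bullet> (y - z) \<le> h y"
proof (rule ccontr)
  assume neg: "\<not> ?thesis"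
  \<comment> \<open>The gap between \<open>h\<close> and its chord is nonpositive and vanishes at the start of the segment,
    so it cannot have a positive slope there.\<close>
  define q where "q s = h (z + s *\<^sub>R (y - z)) - (h z + s * (h y - h z))" for s
  have "(q has_real_derivative D \<bullet> (y - z) - (h y - h z)) (at 0)"
    unfolding q_def[abs_def] by (auto intro!: derivative_eq_intros GDERIV_along_line[OF D])
  moreover have "D \<bullet> (y - z) - (h y - h z) > 0"
    using neg by simp
  ultimately obtain e where e: "e > 0" "\<And>s. 0 < s \<Longrightarrow> s < e \<Longrightarrow> q 0 < q (0 + s)"
    using DERIV_pos_inc_right by blast
  define s where "s = min (e / 2) 1"
  have s: "0 < s" "s < e" "s \<le> 1"
    using e(1) by (auto simp: s_def)
  have "(1 - s) *\<^sub>R z + s *\<^sub>R y = z + s *\<^sub>R (y - z)"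
    by (simp add: algebra_simps)
  then have "q s \<le> 0"
    using conv[of s] s by (simp add: q_def algebra_simps)
  moreover have "q 0 = 0"
    by (simp add: q_def)
  ultimately show False
    using e(2)[of s] s by simp
qed

lemma convex_on_tangent_below:
  fixes f :: "'a::real_inner \<Rightarrow> real"
  assumes "convex_on U f" "GDERIV f z :> D" "z \<in> U" "y \<in> U"
  shows "f z + D \<bullet> (y - z) \<le> f y"
  using assms(2)
proof (rule tangent_below_on_segment)
  show "f ((1 - t) *\<^sub>R z + t *\<^sub>R y) \<le> (1 - t) * f z + t * f y" if "0 \<le> t" "t \<le> 1" for t
    using convex_onD[OF assms(1) that assms(3,4)] .
qed

lemma eproper_finite:
  assumes "eproper \<phi>" "y \<in> edom \<phi>"
  shows "\<phi> y = ereal (real_of_ereal (\<phi> y))"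
  using assms by (cases "\<phi> y") (auto simp: eproper_def edom_def)

lemma econvex_tangent_below:
  fixes \<phi> :: "real ^ 'n \<Rightarrow> ereal"
  assumes "eproper \<phi>" "econvex \<phi>" "edifferentiable_at \<phi> z" "y \<in> edom \<phi>"
  shows "real_of_ereal (\<phi> z) + grad (\<lambda>y. real_of_ereal (\<phi> y)) z \<bullet> (y - z) \<le> real_of_ereal (\<phi> y)"
proof (rule tangent_below_on_segment)
  show "GDERIV (\<lambda>y. real_of_ereal (\<phi> y)) z :> grad (\<lambda>y. real_of_ereal (\<phi> y)) z"
    using assms(3) by (intro GDERIV_grad) (simp add: edifferentiable_at_def)
  have z: "z \<in> edom \<phi>"
    using assms(3) interior_subset by (auto simp: edifferentiable_at_def)
  fix t :: real
  assume t: "0 \<le> t" "t \<le> 1"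
  let ?w = "(1 - t) *\<^sub>R z + t *\<^sub>R y"
  have "\<phi> ?w \<le> ereal (1 - t) * \<phi> z + ereal t * \<phi> y"
    using assms(2) t by (auto simp: econvex_def)
  also have "\<dots> = ereal ((1 - t) * real_of_ereal (\<phi> z) + t * real_of_ereal (\<phi> y))"
    using eproper_finite[OF assms(1) z] eproper_finite[OF assms(1,4)]
    by (metis plus_ereal.simps(1) times_ereal.simps(1))
  finally have le: "\<phi> ?w \<le> ereal ((1 - t) * real_of_ereal (\<phi> z) + t * real_of_ereal (\<phi> y))" .
  then have "?w \<in> edom \<phi>"
    using le_less_trans by (fastforce simp: edom_def)
  from eproper_finite[OF assms(1) this] le
  show "real_of_ereal (\<phi> ?w) \<le> (1 - t) * real_of_ereal (\<phi> z) + t * real_of_ereal (\<phi> y)"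
    by (metis ereal_less_eq(3))
qed

text \<open>From a relatively interior point one can move a little in the direction \<open>p - z\<close> and also
  in the opposite one, so the derivative in that direction vanishes at a minimizer.\<close>

lemma rel_interior_minimizer_gradient:
  fixes h :: "'a::euclidean_space \<Rightarrow> real"
  assumes "convex X" "z \<in> rel_interior X" "p \<in> X"
    and D: "GDERIV h z :> D"
    and min: "\<And>y. y \<in> X \<Longrightarrow> h z \<le> h y"
  shows "D \<bullet> (p - z) = 0"
proof -
  obtain e where e: "e > 1" "(1 - e) *\<^sub>R p + e *\<^sub>R z \<in> X"
    using convex_rel_interior_iff[of X z] assms(1-3) by auto
  have line: "z + s *\<^sub>R (p - z) \<in> X" if s: "1 - e \<le> s" "s \<le> 1" for s
  proof -
    \<comment> \<open>The point lies on the segment from \<open>p\<close> to the point of \<open>X\<close> just beyond \<open>z\<close>.\<close>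
    define k where "k = (1 - s) / e"
    have k: "0 \<le> k" "k \<le> 1"
      using e(1) s by (auto simp: k_def divide_simps)
    have s_eq: "s = 1 - k * e"
      using e(1) by (simp add: k_def)
    have "z + s *\<^sub>R (p - z) = k *\<^sub>R ((1 - e) *\<^sub>R p + e *\<^sub>R z) + (1 - k) *\<^sub>R p"
      unfolding s_eq by (simp add: algebra_simps)
    then show ?thesis
      using convexD[OF assms(1) e(2) assms(3), of k "1 - k"] k by simp
  qed
  show ?thesis
  proof (rule DERIV_local_min)
    show "((\<lambda>s. h (z + s *\<^sub>R (p - z))) has_real_derivative D \<bullet> (p - z)) (at 0)"
      by (rule GDERIV_along_line[OF D])
    show "0 < min 1 (e - 1)"
      using e(1) by simp
    show "\<forall>s. \<bar>0 - s\<bar> < min 1 (e - 1) \<longrightarrow> h (z + 0 *\<^sub>R (p - z)) \<le> h (z + s *\<^sub>R (p - z))"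
      using min line by auto
  qed
qed

lemma Fenchel_inequality:
  assumes conj: "\<And>\<eta>. ereal (\<psi>s \<eta>) = convex_conjugate (\<lambda>x. \<phi> x + convex_indicator X x) \<eta>"
    and "eproper \<phi>" "X \<subseteq> edom \<phi>" "p \<in> X"
  shows "\<eta> \<bullet> p - real_of_ereal (\<phi> p) \<le> \<psi>s \<eta>"
proof -
  have "ereal (\<eta> \<bullet> p) - (\<phi> p + convex_indicator X p) \<le> ereal (\<psi>s \<eta>)"
    unfolding conj convex_conjugate_def by (rule SUP_upper) simp
  moreover have "ereal (\<eta> \<bullet> p) - (\<phi> p + convex_indicator X p)
      = ereal (\<eta> \<bullet> p - real_of_ereal (\<phi> p))"
    using eproper_finite[of \<phi> p] assms(2-4)
    by (cases "\<phi> p") (auto simp: convex_indicator_def)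
  ultimately show ?thesis
    by simp
qed

text \<open>The tangent inequality of \<open>\<phi>\<close> at \<open>z\<close> says that \<open>z\<close> attains the supremum defining the
  conjugate at the slope \<open>g\<close>, which bounds \<open>\<psi>s g\<close> from above; the tangent of \<open>\<psi>s\<close> at \<open>\<eta>\<close>, whose
  slope is \<open>z\<close>, bounds \<open>\<psi>s g\<close> from below. Comparing the bounds moves the equality from \<open>g\<close> to
  \<open>\<eta>\<close>.\<close>

lemma mirror_Fenchel_equality:
  assumes A1: "mirror_assumption1 N X \<psi>s L chi"
    and A2: "mirror_assumption2 X \<phi> \<psi>s chi"
  shows "\<psi>s \<eta> = \<eta> \<bullet> chi \<eta> - real_of_ereal (\<phi> (chi \<eta>))"
proof (rule antisym)
  define z where "z = chi \<eta>"
  define g where "g = grad (\<lambda>y. real_of_ereal (\<phi> y)) z"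
  have z: "z \<in> rel_interior X"
    using A2 by (auto simp: mirror_assumption2_def z_def)
  then have "z \<in> X"
    using rel_interior_subset by blast
  have conj: "\<And>\<eta>. ereal (\<psi>s \<eta>) = convex_conjugate (\<lambda>x. \<phi> x + convex_indicator X x) \<eta>"
    and proper: "eproper \<phi>" and X: "X \<subseteq> edom \<phi>"
    using A2 by (auto simp: mirror_assumption2_def)
  show "\<eta> \<bullet> chi \<eta> - real_of_ereal (\<phi> (chi \<eta>)) \<le> \<psi>s \<eta>"
    using Fenchel_inequality[OF conj proper X \<open>z \<in> X\<close>] by (simp add: z_def)
  have below: "real_of_ereal (\<phi> z) + g \<bullet> (y - z) \<le> real_of_ereal (\<phi> y)" if "y \<in> edom \<phi>" for y
    using A2 z that unfolding g_def
    by (intro econvex_tangent_below) (auto simp: mirror_assumption2_def)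
  have "ereal (\<psi>s g) \<le> ereal (g \<bullet> z - real_of_ereal (\<phi> z))"
    unfolding conj convex_conjugate_def
  proof (rule SUP_least)
    fix y
    show "ereal (g \<bullet> y) - (\<phi> y + convex_indicator X y) \<le> ereal (g \<bullet> z - real_of_ereal (\<phi> z))"
    proof (cases "y \<in> X")
      case True
      then have "y \<in> edom \<phi>"
        using X by auto
      with below[OF this] eproper_finite[OF proper this] True show ?thesis
        by (cases "\<phi> y") (auto simp: convex_indicator_def inner_diff_right)
    next
      case False
      then show ?thesis
        using proper by (auto simp: convex_indicator_def eproper_def)
    qed
  qed
  moreover have "\<psi>s \<eta> + z \<bullet> (g - \<eta>) \<le> \<psi>s g"
    using A1 unfolding z_def
    by (intro convex_on_tangent_below[of UNIV]) (auto simp: mirror_assumption1_def GDERIV_grad)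
  ultimately show "\<psi>s \<eta> \<le> \<eta> \<bullet> chi \<eta> - real_of_ereal (\<phi> (chi \<eta>))"
    by (simp add: z_def inner_diff_right inner_commute)
qed

text \<open>The right-hand side is the gap in the Fenchel inequality for \<open>p\<close> and \<open>\<eta>\<close>. By the Fenchel
  equality at \<open>chi \<eta>\<close> it would be the Bregman divergence at once if the gradient of \<open>\<phi>\<close> there
  were \<open>\<eta>\<close>; the difference of the two is orthogonal to \<open>p - chi \<eta>\<close>, so replacing one by the
  other changes nothing.\<close>

lemma bregman_mirror:
  assumes A1: "mirror_assumption1 N X \<psi>s L chi"
    and A2: "mirror_assumption2 X \<phi> \<psi>s chi"
    and "convex X" "p \<in> X"
  shows "bregman \<phi> p (chi \<eta>) = real_of_ereal (\<phi> p) + \<psi>s \<eta> - \<eta> \<bullet> p"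
proof -
  define z where "z = chi \<eta>"
  define g where "g = grad (\<lambda>y. real_of_ereal (\<phi> y)) z"
  have z: "z \<in> rel_interior X"
    using A2 by (auto simp: mirror_assumption2_def z_def)
  have eq: "\<psi>s \<eta> = \<eta> \<bullet> z - real_of_ereal (\<phi> z)"
    unfolding z_def by (rule mirror_Fenchel_equality[OF A1 A2])
  have "GDERIV (\<lambda>y. real_of_ereal (\<phi> y)) z :> g"
    using A2 z unfolding g_def
    by (intro GDERIV_grad) (auto simp: mirror_assumption2_def edifferentiable_at_def)
  then have D: "GDERIV (\<lambda>y. real_of_ereal (\<phi> y) - \<eta> \<bullet> y) z :> g - \<eta>"
    unfolding gderiv_def
    by (auto intro!: derivative_eq_intros simp: inner_diff_right inner_commute)
  have min: "real_of_ereal (\<phi> z) - \<eta> \<bullet> z \<le> real_of_ereal (\<phi> y) - \<eta> \<bullet> y" if "y \<in> X" for y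
    using Fenchel_inequality[of \<psi>s \<phi> X y \<eta>] A2 that eq by (auto simp: mirror_assumption2_def)
  have "(g - \<eta>) \<bullet> (p - z) = 0"
    by (rule rel_interior_minimizer_gradient[OF assms(3) z assms(4) D min])
  then show ?thesis
    using eq by (simp add: bregman_def z_def g_def algebra_simps inner_diff)
qed

theorem theorem3:
  fixes N :: "real ^ 'n \<Rightarrow> real"
    and X U :: "(real ^ 'n) set"
    and f \<psi>s :: "real ^ 'n \<Rightarrow> real"
    and \<phi> :: "real ^ 'n \<Rightarrow> ereal"
    and chi :: "real ^ 'n \<Rightarrow> real ^ 'n"
    and \<zeta> x :: "real \<Rightarrow> real ^ 'n"
    and xstar :: "real ^ 'n"
    and L r :: real
  assumes "is_norm N"
    and "X \<noteq> {}" "closed X" "convex X"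
    and "open U" "X \<subseteq> U"
    and "convex_on U f" "\<forall>y\<in>U. f differentiable (at y)" "continuous_on U (grad f)"
    and "mirror_assumption1 N X \<psi>s L chi"
    and "mirror_assumption2 X \<phi> \<psi>s chi"
    and "is_arg_min f (\<lambda>y. y \<in> X) xstar"
    and "r \<ge> 2"
    and "accelerated_mirror_solution X f chi r \<zeta> x"
  shows "\<forall>t>0. \<exists>D. ((\<lambda>s. Vhat f \<phi> chi r xstar (x s) (\<zeta> s) s) has_real_derivative D) (at t) \<and> D \<le> 0"
proof (intro allI impI)
  fix t :: real
  assume t: "t > 0"
  have xstar: "xstar \<in> X" and opt: "\<And>y. y \<in> X \<Longrightarrow> f xstar \<le> f y"
    using assms(12) by (auto simp: is_arg_min_linorder)
  have xt: "x t \<in> X"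
    and d\<zeta>: "(\<zeta> has_vector_derivative (- (t / r) *\<^sub>R grad f (x t))) (at t)"
    and dx: "(x has_vector_derivative ((r / t) *\<^sub>R (chi (\<zeta> t) - x t))) (at t)"
    using assms(14) t by (auto simp: accelerated_mirror_solution_def)
  define G where "G = grad f (x t)"
  define gap where "gap = f (x t) - f xstar"
  have Gf: "GDERIV f (x t) :> G"
    using assms(6,8) xt unfolding G_def by (intro GDERIV_grad) auto
  have G\<psi>: "GDERIV \<psi>s (\<zeta> t) :> chi (\<zeta> t)"
    using assms(10) by (auto simp: mirror_assumption1_def intro: GDERIV_grad)
  have df: "((\<lambda>s. f (x s)) has_real_derivative G \<bullet> ((r / t) *\<^sub>R (chi (\<zeta> t) - x t))) (at t)"
    by (rule GDERIV_vector_derivative[OF Gf dx])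
  have d\<psi>: "((\<lambda>s. \<psi>s (\<zeta> s)) has_real_derivative chi (\<zeta> t) \<bullet> (- (t / r) *\<^sub>R G)) (at t)"
    using GDERIV_vector_derivative[OF G\<psi> d\<zeta>] by (simp add: G_def)
  have "GDERIV (\<lambda>\<eta>. \<eta> \<bullet> xstar) (\<zeta> t) :> xstar"
    by (auto simp: gderiv_def intro!: derivative_eq_intros)
  from GDERIV_vector_derivative[OF this d\<zeta>]
  have dl: "((\<lambda>s. \<zeta> s \<bullet> xstar) has_real_derivative xstar \<bullet> (- (t / r) *\<^sub>R G)) (at t)"
    by (simp add: G_def)
  have "((\<lambda>s. s\<^sup>2) has_real_derivative 2 * t) (at t)"
    by (auto intro!: derivative_eq_intros)
  then have dsq: "((\<lambda>s. s\<^sup>2 / r\<^sup>2) has_real_derivative 2 * t / r\<^sup>2) (at t)"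
    by (rule DERIV_cdivide)
  have V: "Vhat f \<phi> chi r xstar (x s) (\<zeta> s) s
      = s\<^sup>2 / r\<^sup>2 * (f (x s) - f xstar) + (real_of_ereal (\<phi> xstar) + \<psi>s (\<zeta> s) - \<zeta> s \<bullet> xstar)" for s
    unfolding Vhat_def bregman_mirror[OF assms(10,11,4) xstar] by simp
  define D where "D = 2 * t / r\<^sup>2 * gap + t / r * (G \<bullet> (xstar - x t))"
  have f_term: "t\<^sup>2 / r\<^sup>2 * (G \<bullet> ((r / t) *\<^sub>R (chi (\<zeta> t) - x t)))
      = t / r * (G \<bullet> (chi (\<zeta> t) - x t))"
    using t assms(13) by (simp add: power2_eq_square)
  have "((\<lambda>s. Vhat f \<phi> chi r xstar (x s) (\<zeta> s) s) has_real_derivative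
      2 * t / r\<^sup>2 * gap + t\<^sup>2 / r\<^sup>2 * (G \<bullet> ((r / t) *\<^sub>R (chi (\<zeta> t) - x t)))
        + (chi (\<zeta> t) \<bullet> (- (t / r) *\<^sub>R G) - xstar \<bullet> (- (t / r) *\<^sub>R G))) (at t)"
    unfolding V gap_def
    by (rule DERIV_cong[OF DERIV_add[OF DERIV_mult[OF dsq DERIV_diff[OF df DERIV_const]]
          DERIV_diff[OF DERIV_add[OF DERIV_const d\<psi>] dl]]]) (simp add: mult_ac)
  then have "((\<lambda>s. Vhat f \<phi> chi r xstar (x s) (\<zeta> s) s) has_real_derivative D) (at t)"
    unfolding f_term
    by (rule DERIV_cong) (simp add: D_def algebra_simps inner_diff inner_commute)
  moreover have "D \<le> 0"
  proof -
    have "f (x t) + G \<bullet> (xstar - x t) \<le> f xstar"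
      using convex_on_tangent_below[OF assms(7) Gf] xt xstar assms(6) by blast
    then have "G \<bullet> (xstar - x t) \<le> - gap"
      by (simp add: gap_def)
    then have "t / r * (G \<bullet> (xstar - x t)) \<le> t / r * (- gap)"
      using t assms(13) by (intro mult_left_mono) auto
    then have "D \<le> 2 * t / r\<^sup>2 * gap + t / r * (- gap)"
      by (simp add: D_def)
    also have "\<dots> = - (t / r\<^sup>2 * (r - 2) * gap)"
      using assms(13) by (simp add: field_simps power2_eq_square)
    also have "\<dots> \<le> 0"
      using t assms(13) opt[OF xt] by (simp add: gap_def)
    finally show ?thesis .
  qed
  ultimately show "\<exists>D. ((\<lambda>s. Vhat f \<phi> chi r xstar (x s) (\<zeta> s) s) has_real_derivative D) (at t)
      \<and> D \<le> 0"
    by blast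
qed

end
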